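(* Let $n\ge 0$. The number of self-duals $\lambda_{n+4}$ satisfies $$\lambda_{n+4}=\sum_{a,b,c\in D_n}\ \sum_{\substack{h\in D_n \\ h \ge (a|b|c|a^*|b^*|c^* )}} re(a|b|c,h)\cdot re(a|b^*|c^*,h)\cdot re(b|a^*|c^*,h)\cdot re(c|a^*|b^*,h).$$
   Context: $B=\{0,1\}$ with $0\le 1$, and $B^n$ carries the componentwise partial order. $D_n$ is the set of monotone functions $B^n\to B$ (monotone Boolean functions of $n$ variables), ordered pointwise. Elements of $D_n$ are represented as bit strings of length $2^n$: $D_0=\{0,1\}$, and $g\in D_n$ with $n>0$ is represented as the concatenation $g_0\cdot g_1$ with $g_0,g_1\in D_{n-1}$, $g_0\le g_1$, where $g_i$ is the restriction of $g$ to last coordinate equal to $i$. The dual $x^*\in D_n$ of $x\in D_n$ is obtained by reversing the string and negating all its bits (equivalently, $x^*(v)=\neg x(\neg v)$ for $v\in B^n$, with $\neg v$ the componentwise negation). An element $x$ is self-dual if $x=x^*$, and $\lambda_n$ is the number of self-dual elements of $D_n$. $x|y$ is bitwise or; $re(x,y)=|\{z\in D_n: x\le z\le y\}|$. *)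

theory Defs
  imports "HOL-Library.FuncSet"
begin

unbundle lattice_syntax

definition cube :: "nat \<Rightarrow> bool list set" where
  "cube n = {v. length v = n}"

definition vle :: "bool list \<Rightarrow> bool list \<Rightarrow> bool" where
  "vle = list_all2 (\<le>)"

(* Functions are extensional (set to undefined outside the cube). Hence equality, \<le> and \<squnion>
   of the type "bool list \<Rightarrow> bool" agree on D n with equality, the pointwise order and the
   pointwise disjunction of functions on the cube. *)
definition D :: "nat \<Rightarrow> (bool list \<Rightarrow> bool) set" where
  "D n = {f \<in> cube n \<rightarrow>\<^sub>E UNIV. monotone_on (cube n) vle (\<le>) f}"

definition dual :: "nat \<Rightarrow> (bool list \<Rightarrow> bool) \<Rightarrow> (bool list \<Rightarrow> bool)" where
  "dual n x = (\<lambda>v\<in>cube n. \<not> x (map Not v))"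

definition self_dual :: "nat \<Rightarrow> (bool list \<Rightarrow> bool) \<Rightarrow> bool" where
  "self_dual n x \<longleftrightarrow> x = dual n x"

definition num_self_dual :: "nat \<Rightarrow> nat" where
  "num_self_dual n = card {x \<in> D n. self_dual n x}"

definition re :: "nat \<Rightarrow> (bool list \<Rightarrow> bool) \<Rightarrow> (bool list \<Rightarrow> bool) \<Rightarrow> nat" where
  "re n x y = card {z \<in> D n. x \<le> z \<and> z \<le> y}"

(* Sums over D n and cardinalities of its subsets are not degenerate. *)
lemma finite_D: "finite (D n)"
proof -
  have "finite (cube n)"
    using finite_lists_length_eq[of "UNIV :: bool set" n] by (simp add: cube_def)
  then have "finite (cube n \<rightarrow>\<^sub>E (UNIV :: bool set))"
    by (intro finite_PiE) auto
  then show ?thesis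
    by (rule rev_finite_subset) (auto simp: D_def)
qed

(* The bit string of length 2 ^ n representing g: the string of the restriction of g to last
   coordinate 0, followed by that of the restriction to last coordinate 1. *)
fun bits :: "nat \<Rightarrow> (bool list \<Rightarrow> bool) \<Rightarrow> bool list" where
  "bits 0 g = [g []]"
| "bits (Suc n) g = bits n (\<lambda>v. g (v @ [False])) @ bits n (\<lambda>v. g (v @ [True]))"

lemma bits_cong: "(\<And>v. v \<in> cube n \<Longrightarrow> f v = g v) \<Longrightarrow> bits n f = bits n g"
proof (induction n arbitrary: f g)
  case (Suc n)
  have "bits n (\<lambda>v. f (v @ [b])) = bits n (\<lambda>v. g (v @ [b]))" for b
    by (rule Suc.IH) (simp add: Suc.prems cube_def)
  then show ?case by simp
qed (simp add: cube_def)

(* The dual reverses the string and negates all its bits. *)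
lemma bits_dual: "bits n (dual n x) = map Not (rev (bits n x))"
proof -
  have "bits n (\<lambda>v. \<not> x (map Not v)) = map Not (rev (bits n x))" for x
  proof (induction n arbitrary: x)
    case (Suc n)
    show ?case
      using Suc.IH[of "\<lambda>v. x (v @ [True])"] Suc.IH[of "\<lambda>v. x (v @ [False])"] by simp
  qed simp
  moreover have "bits n (dual n x) = bits n (\<lambda>v. \<not> x (map Not v))"
    by (rule bits_cong) (simp add: dual_def)
  ultimately show ?thesis by simp
qed

end

theory Submission
  imports Defs
begin

text \<open>
  Cut a self-dual function of \<open>n + 4\<close> variables along its last four coordinates. This gives sixteen
  functions of \<open>n\<close> variables, one for each vertex \<open>s\<close> of the cube of dimension 4. Monotonicity of the
  whole says that every slice lies in \<open>D n\<close> and that the slices increase with \<open>s\<close>; self-duality says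
  that the slice at the antipode of \<open>s\<close> is the dual of the slice at \<open>s\<close> (\<open>bij_betw_slices\<close>).

  Of two antipodal slices either one determines the other, so eight slices suffice: the top one \<open>h\<close>,
  the four of weight 3 just below it, and one from each of the three antipodal pairs of weight 2.
  Choose the latter to be the slices \<open>a\<close>, \<open>b\<close>, \<open>c\<close> at the two-element subsets of \<open>{1, 2, 3}\<close>. Each
  vertex of weight 3 covers three vertices of weight 2, and these carry one of
  \<open>{a, b, c}\<close>, \<open>{a, b\<^sup>*, c\<^sup>*}\<close>, \<open>{b, a\<^sup>*, c\<^sup>*}\<close>, \<open>{c, a\<^sup>*, b\<^sup>*}\<close>. Hence, once \<open>a\<close>, \<open>b\<close>, \<open>c\<close> and \<open>h\<close> are
  fixed, the four slices of weight 3 range independently over the intervals counted by the four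
  factors \<open>re\<close>. The remaining inequalities, those that involve the lower half of the cube, follow
  because dualising reverses the order (\<open>bij_betw_upper_half\<close>). Counting the eight-tuples gives
  the sum (\<open>card_upper_halves\<close>).
\<close>

section \<open>Duality\<close>

lemma map_Not_cube_iff [simp]: "map Not v \<in> cube n \<longleftrightarrow> v \<in> cube n"
  by (simp add: cube_def)

lemma vle_map_Not: "vle (map Not v) (map Not w) \<longleftrightarrow> vle w v"
  by (auto simp: vle_def list_all2_conv_all_nth)

lemma vle_refl [simp]: "vle v v"
  by (auto simp: vle_def list_all2_conv_all_nth)

lemma vle_append:
  assumes "v \<in> cube n" "w \<in> cube n"
  shows "vle (v @ s) (w @ t) \<longleftrightarrow> vle v w \<and> vle s t"
  using assms by (simp add: vle_def cube_def list_all2_append)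

lemma D_D:
  assumes "x \<in> D n"
  shows D_extensional: "x \<in> extensional (cube n)"
    and D_mono: "\<And>v w. \<lbrakk>v \<in> cube n; w \<in> cube n; vle v w; x v\<rbrakk> \<Longrightarrow> x w"
  using assms by (auto simp: D_def PiE_def monotone_on_def)

lemma D_I:
  assumes "x \<in> extensional (cube n)"
    and "\<And>v w. \<lbrakk>v \<in> cube n; w \<in> cube n; vle v w; x v\<rbrakk> \<Longrightarrow> x w"
  shows "x \<in> D n"
  using assms by (auto simp: D_def PiE_def monotone_on_def)

lemma dual_in_D:
  assumes "x \<in> D n"
  shows "dual n x \<in> D n"
proof (rule D_I)
  fix v w
  assume "v \<in> cube n" "w \<in> cube n" "vle v w" "dual n x v"
  then show "dual n x w"
    using D_mono[OF assms, of "map Not w" "map Not v"] by (auto simp: dual_def vle_map_Not)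
qed (simp add: dual_def)

lemma dual_dual:
  assumes "x \<in> D n"
  shows "dual n (dual n x) = x"
proof
  fix v
  show "dual n (dual n x) v = x v"
    using D_extensional[OF assms] by (cases "v \<in> cube n") (auto simp: dual_def extensional_def comp_def)
qed

lemma dual_antitone: "x \<le> y \<Longrightarrow> dual n y \<le> dual n x"
  by (auto simp: dual_def le_fun_def)

section \<open>Slicing a function along its last coordinates\<close>

definition slices :: "nat \<Rightarrow> nat \<Rightarrow> (bool list \<Rightarrow> bool) \<Rightarrow> bool list \<Rightarrow> (bool list \<Rightarrow> bool)" where
  "slices n m g = (\<lambda>s\<in>cube m. \<lambda>v\<in>cube n. g (v @ s))"

definition unslice :: "nat \<Rightarrow> nat \<Rightarrow> (bool list \<Rightarrow> (bool list \<Rightarrow> bool)) \<Rightarrow> bool list \<Rightarrow> bool" where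
  "unslice n m F = (\<lambda>w\<in>cube (n + m). F (drop n w) (take n w))"

text \<open>
  The maps from one cube to \<open>D n\<close> that are monotone and turn the antipodal map into duality.
  They are extensional, so that distinct maps differ on the cube.
\<close>

definition self_dual_families :: "nat \<Rightarrow> nat \<Rightarrow> (bool list \<Rightarrow> (bool list \<Rightarrow> bool)) set" where
  "self_dual_families n m =
    {F \<in> cube m \<rightarrow>\<^sub>E D n. monotone_on (cube m) vle (\<le>) F \<and>
      (\<forall>s\<in>cube m. F (map Not s) = dual n (F s))}"

lemma cube_add_split:
  assumes "w \<in> cube (n + m)"
  obtains v s where "v \<in> cube n" "s \<in> cube m" "w = v @ s"
  using assms that[of "take n w" "drop n w"] by (auto simp: cube_def)

lemma append_in_cube: "v \<in> cube n \<Longrightarrow> s \<in> cube m \<Longrightarrow> v @ s \<in> cube (n + m)"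
  by (simp add: cube_def)

lemma slices_apply: "v \<in> cube n \<Longrightarrow> s \<in> cube m \<Longrightarrow> slices n m g s v = g (v @ s)"
  by (simp add: slices_def)

lemma unslice_append: "v \<in> cube n \<Longrightarrow> s \<in> cube m \<Longrightarrow> unslice n m F (v @ s) = F s v"
  by (simp add: unslice_def cube_def)

lemma self_dual_familiesD:
  assumes "F \<in> self_dual_families n m" "s \<in> cube m"
  shows "F s \<in> D n" and "F (map Not s) = dual n (F s)"
    and "\<And>t. \<lbrakk>t \<in> cube m; vle s t\<rbrakk> \<Longrightarrow> F s \<le> F t"
  using assms by (auto simp: self_dual_families_def monotone_on_def)

lemma slices_in_self_dual_families:
  assumes g: "g \<in> D (n + m)" and dual: "self_dual (n + m) g"
  shows "slices n m g \<in> self_dual_families n m"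
proof -
  have "slices n m g s \<in> D n" if s: "s \<in> cube m" for s
  proof (rule D_I)
    show "slices n m g s \<in> extensional (cube n)"
      using s by (simp add: slices_def)
    show "slices n m g s w"
      if "v \<in> cube n" "w \<in> cube n" "vle v w" "slices n m g s v" for v w
      using that s D_mono[OF g, of "v @ s" "w @ s"]
      by (simp add: slices_apply append_in_cube vle_append)
  qed
  moreover have "monotone_on (cube m) vle (\<le>) (slices n m g)"
  proof (intro monotone_onI le_funI)
    fix s t v
    assume "s \<in> cube m" "t \<in> cube m" "vle s t"
    then show "slices n m g s v \<le> slices n m g t v"
      using D_mono[OF g, of "v @ s" "v @ t"]
      by (cases "v \<in> cube n") (auto simp: slices_def append_in_cube vle_append)
  qed
  moreover have "slices n m g (map Not s) = dual n (slices n m g s)" if s: "s \<in> cube m" for s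
  proof
    fix v
    show "slices n m g (map Not s) v = dual n (slices n m g s) v"
    proof (cases "v \<in> cube n")
      case True
      then have "g (v @ map Not s) = dual (n + m) g (v @ map Not s)"
        using dual by (simp add: self_dual_def)
      also have "\<dots> \<longleftrightarrow> \<not> g (map Not v @ s)"
        using True s by (simp add: dual_def append_in_cube comp_def)
      finally show ?thesis
        using True s by (simp add: slices_apply dual_def)
    qed (use s in \<open>simp add: slices_def dual_def\<close>)
  qed
  ultimately show ?thesis
    by (auto simp: self_dual_families_def slices_def)
qed

lemma unslice_self_dual:
  assumes "F \<in> self_dual_families n m"
  shows "unslice n m F \<in> D (n + m)" and "self_dual (n + m) (unslice n m F)"
proof -
  note F = self_dual_familiesD[OF assms]
  show "unslice n m F \<in> D (n + m)"
  proof (rule D_I)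
    fix w w'
    assume w: "w \<in> cube (n + m)" "w' \<in> cube (n + m)" and le: "vle w w'" and true: "unslice n m F w"
    obtain v s where v: "v \<in> cube n" "s \<in> cube m" "w = v @ s"
      using w by (blast elim: cube_add_split)
    obtain v' s' where v': "v' \<in> cube n" "s' \<in> cube m" "w' = v' @ s'"
      using w by (blast elim: cube_add_split)
    have "vle v v'" "vle s s'" "F s v"
      using le true v v' by (simp_all add: vle_append unslice_append)
    then have "F s v'"
      using F(1) v v' by (blast intro: D_mono)
    then have "F s' v'"
      using F(3)[OF \<open>s \<in> cube m\<close> \<open>s' \<in> cube m\<close> \<open>vle s s'\<close>] by (auto simp: le_fun_def)
    then show "unslice n m F w'"
      using v' by (simp add: unslice_append)
  qed (simp add: unslice_def)
  show "self_dual (n + m) (unslice n m F)"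
    unfolding self_dual_def
  proof
    fix w
    show "unslice n m F w = dual (n + m) (unslice n m F) w"
    proof (cases "w \<in> cube (n + m)")
      case True
      then obtain v s where v: "v \<in> cube n" "s \<in> cube m" "w = v @ s"
        by (blast elim: cube_add_split)
      have "unslice n m F (map Not v @ map Not s) = F (map Not s) (map Not v)"
        using v by (intro unslice_append) auto
      then show ?thesis
        using v True F(2)[of s]
        by (simp add: unslice_append dual_def comp_def)
    qed (simp add: unslice_def dual_def)
  qed
qed

text \<open>
  The order on the cube of dimension \<open>n + m\<close> is the product order, so a function is monotone iff it
  is monotone in both groups of coordinates; the antipodal map also acts on both groups
  separately. Both conditions on a function thus become conditions on its slices.
\<close>

lemma bij_betw_slices:
  "bij_betw (slices n m) {g \<in> D (n + m). self_dual (n + m) g} (self_dual_families n m)"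
proof (rule bij_betw_byWitness[where f' = "unslice n m"])
  show "\<forall>g\<in>{g \<in> D (n + m). self_dual (n + m) g}. unslice n m (slices n m g) = g"
  proof (intro ballI ext)
    fix g w
    assume g: "g \<in> {g \<in> D (n + m). self_dual (n + m) g}"
    show "unslice n m (slices n m g) w = g w"
    proof (cases "w \<in> cube (n + m)")
      case True
      then show ?thesis
        by (auto elim!: cube_add_split simp: unslice_append slices_apply)
    next
      case False
      then show ?thesis
        using g by (auto simp: unslice_def dest!: D_extensional extensional_arb)
    qed
  qed
  show "\<forall>F\<in>self_dual_families n m. slices n m (unslice n m F) = F"
  proof (intro ballI ext)
    fix F s v
    assume F: "F \<in> self_dual_families n m"
    have ext: "F s v = undefined" if "s \<in> cube m" "v \<notin> cube n"
      by (rule extensional_arb[OF D_extensional[OF self_dual_familiesD(1)[OF F that(1)]] that(2)])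
    have "F s = undefined" if "s \<notin> cube m"
      using F that by (auto simp: self_dual_families_def intro: PiE_arb)
    then show "slices n m (unslice n m F) s v = F s v"
      using ext by (cases "s \<in> cube m"; cases "v \<in> cube n") (simp_all add: slices_def unslice_append)
  qed
qed (auto intro: slices_in_self_dual_families unslice_self_dual)

section \<open>Four coordinates\<close>

text \<open>
  A vertex of the cube of dimension 4 is the indicator list of a subset of \<open>{1, 2, 3, 4}\<close>. The
  slices \<open>a\<close>, \<open>b\<close>, \<open>c\<close> belong to \<open>{1, 2}\<close>, \<open>{1, 3}\<close>, \<open>{2, 3}\<close>, so that their duals belong to
  \<open>{3, 4}\<close>, \<open>{2, 4}\<close>, \<open>{1, 4}\<close>.
\<close>

definition interval :: "nat \<Rightarrow> (bool list \<Rightarrow> bool) \<Rightarrow> (bool list \<Rightarrow> bool) \<Rightarrow> (bool list \<Rightarrow> bool) set" where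
  "interval n x y = {z \<in> D n. x \<le> z \<and> z \<le> y}"

text \<open>
  The four intervals are those of the slices at \<open>{1, 2, 3}\<close>, \<open>{1, 2, 4}\<close>, \<open>{1, 3, 4}\<close>, \<open>{2, 3, 4}\<close>,
  in this order: each lower bound joins the slices at the three two-element subsets.
\<close>

definition upper_halves where
  "upper_halves n =
    (SIGMA a:D n. SIGMA b:D n. SIGMA c:D n.
      SIGMA h:{h \<in> D n. h \<ge> a \<squnion> b \<squnion> c \<squnion> dual n a \<squnion> dual n b \<squnion> dual n c}.
        interval n (a \<squnion> b \<squnion> c) h
        \<times> interval n (a \<squnion> dual n b \<squnion> dual n c) h
        \<times> interval n (b \<squnion> dual n a \<squnion> dual n c) h
        \<times> interval n (c \<squnion> dual n a \<squnion> dual n b) h)"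

definition upper_half where
  "upper_half F =
    (F [True, True, False, False], F [True, False, True, False], F [False, True, True, False],
     F [True, True, True, True],
     F [True, True, True, False], F [True, True, False, True],
     F [True, False, True, True], F [False, True, True, True])"

text \<open>
  Each row holds a pair of antipodal vertices; the tuple supplies the slice at the first one.
\<close>

fun lower_completion where
  "lower_completion n (a, b, c, h, p, q, r, t) =
    (\<lambda>s\<in>cube 4. the (map_of
      [([True, True, False, False], a), ([False, False, True, True], dual n a),
       ([True, False, True, False], b), ([False, True, False, True], dual n b),
       ([False, True, True, False], c), ([True, False, False, True], dual n c),
       ([True, True, True, True], h), ([False, False, False, False], dual n h),
       ([True, True, True, False], p), ([False, False, False, True], dual n p),
       ([True, True, False, True], q), ([False, False, True, False], dual n q),
       ([True, False, True, True], r), ([False, True, False, False], dual n r),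
       ([False, True, True, True], t), ([True, False, False, False], dual n t)] s))"

lemma cube_4:
  assumes "s \<in> cube 4"
  obtains i j k l where "s = [i, j, k, l]"
  using assms by (auto simp: cube_def numeral_eq_Suc length_Suc_conv)

lemma cube_4_intro [simp]: "[i, j, k, l] \<in> cube 4"
  by (simp add: cube_def)

lemma vle_4 [simp]:
  "vle [i, j, k, l] [i', j', k', l'] \<longleftrightarrow> i \<le> i' \<and> j \<le> j' \<and> k \<le> k' \<and> l \<le> l'"
  by (simp add: vle_def)

lemma lower_completion_apply:
  assumes "x = (a, b, c, h, p, q, r, t)"
  shows
    "lower_completion n x [True, True, False, False] = a"
    "lower_completion n x [False, False, True, True] = dual n a"
    "lower_completion n x [True, False, True, False] = b"
    "lower_completion n x [False, True, False, True] = dual n b"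
    "lower_completion n x [False, True, True, False] = c"
    "lower_completion n x [True, False, False, True] = dual n c"
    "lower_completion n x [True, True, True, True] = h"
    "lower_completion n x [False, False, False, False] = dual n h"
    "lower_completion n x [True, True, True, False] = p"
    "lower_completion n x [False, False, False, True] = dual n p"
    "lower_completion n x [True, True, False, True] = q"
    "lower_completion n x [False, False, True, False] = dual n q"
    "lower_completion n x [True, False, True, True] = r"
    "lower_completion n x [False, True, False, False] = dual n r"
    "lower_completion n x [False, True, True, True] = t"
    "lower_completion n x [True, False, False, False] = dual n t"
  by (simp_all add: assms)

lemma lower_completion_extensional: "lower_completion n x \<in> extensional (cube 4)"
  by (metis lower_completion.simps restrict_extensional surj_pair)

declare lower_completion.simps [simp del]

text \<open>
  Membership in \<open>upper_halves\<close> supplies the comparisons along the edges between the layers of weight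
  2, 3 and 4. Duality reflects them to the edges between the layers of weight 0, 1 and 2, and all
  other comparisons in the cube are chains of edges.
\<close>

lemma lower_completion_in_self_dual_families:
  assumes "x \<in> upper_halves n"
  shows "lower_completion n x \<in> self_dual_families n 4"
proof -
  obtain a b c h p q r t where x: "x = (a, b, c, h, p, q, r, t)"
    by (metis surj_pair)
  let ?F = "lower_completion n x"
  have D: "a \<in> D n" "b \<in> D n" "c \<in> D n" "h \<in> D n" "p \<in> D n" "q \<in> D n" "r \<in> D n" "t \<in> D n"
    using assms by (auto simp: x upper_halves_def interval_def)
  have upper:
    "a \<le> p" "b \<le> p" "c \<le> p" "a \<le> q" "dual n b \<le> q" "dual n c \<le> q"
    "b \<le> r" "dual n a \<le> r" "dual n c \<le> r" "c \<le> t" "dual n a \<le> t" "dual n b \<le> t"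
    "p \<le> h" "q \<le> h" "r \<le> h" "t \<le> h"
    using assms by (auto simp: x upper_halves_def interval_def)
  have lower:
    "dual n p \<le> dual n a" "dual n p \<le> dual n b" "dual n p \<le> dual n c"
    "dual n q \<le> dual n a" "dual n q \<le> b" "dual n q \<le> c"
    "dual n r \<le> dual n b" "dual n r \<le> a" "dual n r \<le> c"
    "dual n t \<le> dual n c" "dual n t \<le> a" "dual n t \<le> b"
    "dual n h \<le> dual n p" "dual n h \<le> dual n q" "dual n h \<le> dual n r" "dual n h \<le> dual n t"
    using upper[THEN dual_antitone, of n] by (simp_all add: dual_dual D)
  have "?F s \<in> D n" if "s \<in> cube 4" for s
    using that
  proof (rule cube_4)
    fix i j k l assume "s = [i, j, k, l]"
    then show ?thesis
      by (cases i; cases j; cases k; cases l) (simp_all add: lower_completion_apply[OF x] D dual_in_D)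
  qed
  moreover have "?F (map Not s) = dual n (?F s)" if "s \<in> cube 4" for s
    using that
  proof (rule cube_4)
    fix i j k l assume "s = [i, j, k, l]"
    then show ?thesis
      by (cases i; cases j; cases k; cases l) (simp_all add: lower_completion_apply[OF x] D dual_dual)
  qed
  moreover have "?F s \<le> ?F s'" if s: "s \<in> cube 4" "s' \<in> cube 4" "vle s s'" for s s'
  proof -
    (* From weight 1 to weight 3, through a slice of weight 2. *)
    have middle: "dual n p \<le> q" "dual n p \<le> r" "dual n p \<le> t" "dual n q \<le> p" "dual n q \<le> r" "dual n q \<le> t"
      "dual n r \<le> p" "dual n r \<le> q" "dual n r \<le> t" "dual n t \<le> p" "dual n t \<le> q" "dual n t \<le> r"
      using upper lower by order+
    (* Between weight 2 and the top or the bottom. *)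
    have ends: "a \<le> h" "b \<le> h" "c \<le> h" "dual n a \<le> h" "dual n b \<le> h" "dual n c \<le> h"
      "dual n h \<le> a" "dual n h \<le> b" "dual n h \<le> c"
      "dual n h \<le> dual n a" "dual n h \<le> dual n b" "dual n h \<le> dual n c"
      using upper lower by order+
    (* From weight 1 to the top, and from the bottom to weight 3 and to the top. *)
    have far: "dual n p \<le> h" "dual n q \<le> h" "dual n r \<le> h" "dual n t \<le> h"
      "dual n h \<le> p" "dual n h \<le> q" "dual n h \<le> r" "dual n h \<le> t" "dual n h \<le> h"
      using upper lower ends by order+
    obtain i j k l where "s = [i, j, k, l]" using s(1) by (rule cube_4)
    moreover obtain i' j' k' l' where "s' = [i', j', k', l']" using s(2) by (rule cube_4)
    ultimately show ?thesis
      using s(3)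
      by (cases i; cases j; cases k; cases l; cases i'; cases j'; cases k'; cases l')
        (simp_all add: lower_completion_apply[OF x] upper lower middle ends far)
  qed
  moreover have "?F \<in> extensional (cube 4)"
    by (rule lower_completion_extensional)
  ultimately show ?thesis
    by (auto simp: self_dual_families_def monotone_on_def PiE_def)
qed

lemma upper_half_in_upper_halves:
  assumes "F \<in> self_dual_families n 4"
  shows "upper_half F \<in> upper_halves n"
proof -
  have F: "F [i, j, k, l] \<in> D n" for i j k l
    using self_dual_familiesD(1)[OF assms] by simp
  have dual: "dual n (F [i, j, k, l]) = F [\<not> i, \<not> j, \<not> k, \<not> l]" for i j k l
    using self_dual_familiesD(2)[OF assms, of "[i, j, k, l]"] by simp
  have mono: "F [i, j, k, l] \<le> F [i', j', k', l']"
    if "i \<le> i'" "j \<le> j'" "k \<le> k'" "l \<le> l'" for i j k l i' j' k' l'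
    using self_dual_familiesD(3)[OF assms] that by simp
  show ?thesis
    by (simp add: upper_half_def upper_halves_def interval_def F dual mono)
qed

lemma bij_betw_upper_half: "bij_betw upper_half (self_dual_families n 4) (upper_halves n)"
proof (rule bij_betw_byWitness[where f' = "lower_completion n"])
  show "\<forall>F\<in>self_dual_families n 4. lower_completion n (upper_half F) = F"
  proof (rule ballI, rule ext)
    fix F s
    assume F: "F \<in> self_dual_families n 4"
    show "lower_completion n (upper_half F) s = F s"
    proof (cases "s \<in> cube 4")
      case True
      have dual: "dual n (F [i, j, k, l]) = F [\<not> i, \<not> j, \<not> k, \<not> l]" for i j k l
        using self_dual_familiesD(2)[OF F, of "[i, j, k, l]"] by simp
      obtain i j k l where "s = [i, j, k, l]" using True by (rule cube_4)
      then show ?thesis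
        by (cases i; cases j; cases k; cases l) (simp_all add: lower_completion_apply[OF upper_half_def] dual)
    next
      case False
      then have "F s = undefined"
        using F by (auto simp: self_dual_families_def intro: PiE_arb)
      then show ?thesis
        using False by (simp add: extensional_arb[OF lower_completion_extensional])
    qed
  qed
  show "\<forall>x\<in>upper_halves n. upper_half (lower_completion n x) = x"
    by (auto simp: upper_half_def lower_completion_apply[OF refl])
qed (auto intro: upper_half_in_upper_halves lower_completion_in_self_dual_families)

lemma card_upper_halves:
  "card (upper_halves n) =
    (\<Sum>a\<in>D n. \<Sum>b\<in>D n. \<Sum>c\<in>D n.
      \<Sum>h\<in>{h \<in> D n. h \<ge> a \<squnion> b \<squnion> c \<squnion> dual n a \<squnion> dual n b \<squnion> dual n c}.
        re n (a \<squnion> b \<squnion> c) h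
        * re n (a \<squnion> dual n b \<squnion> dual n c) h
        * re n (b \<squnion> dual n a \<squnion> dual n c) h
        * re n (c \<squnion> dual n a \<squnion> dual n b) h)"
proof -
  have "finite (interval n x y)" for x y
    using finite_D[of n] by (simp add: interval_def)
  moreover have "card (interval n x y) = re n x y" for x y
    by (simp add: interval_def re_def)
  ultimately show ?thesis
    using finite_D[of n]
    by (simp add: upper_halves_def finite_SigmaI mult.assoc card_cartesian_product)
qed

theorem lemma9:
  fixes n :: nat
  shows "num_self_dual (n + 4) =
    (\<Sum>a\<in>D n. \<Sum>b\<in>D n. \<Sum>c\<in>D n.
      \<Sum>h\<in>{h \<in> D n. h \<ge> a \<squnion> b \<squnion> c \<squnion> dual n a \<squnion> dual n b \<squnion> dual n c}.
        re n (a \<squnion> b \<squnion> c) h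
        * re n (a \<squnion> dual n b \<squnion> dual n c) h
        * re n (b \<squnion> dual n a \<squnion> dual n c) h
        * re n (c \<squnion> dual n a \<squnion> dual n b) h)"
proof -
  have "num_self_dual (n + 4) = card (upper_halves n)"
    unfolding num_self_dual_def
    by (rule bij_betw_same_card[OF bij_betw_trans[OF bij_betw_slices bij_betw_upper_half]])
  then show ?thesis
    by (simp only: card_upper_halves)
qed

end
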